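(* The set $Z_{60}\subset\mathbb{P}^3$ is not an $(a,b)$-grid for any choice of positive integers $a,b$.
   Context: We work over $\mathbb{C}$. The Klein configuration $Z_{60}\subset\mathbb{P}^3=\mathbb{P}^3_{\mathbb{C}}$ (homogeneous coordinates $[x:y:z:w]$) is the following set of $60$ points: the $4$ coordinate points $[1:0:0:0],[0:1:0:0],[0:0:1:0],[0:0:0:1]$; the $24$ points having exactly two nonzero coordinates, the first nonzero coordinate being $1$ and the other one lying in $\{1,i,-1,-i\}$; and the $32$ points $[1:\pm1:\pm1:\pm1]$, $[1:\pm1:\pm i:\pm i]$, $[1:\pm i:\pm1:\pm i]$, $[1:\pm i:\pm i:\pm1]$ (all signs chosen independently). Let $a,b$ be positive integers. A set $Z$ of $ab$ points in $\mathbb{P}^3$ is an $(a,b)$-grid if there exist a set of pairwise skew lines $\ell_1,\dots,\ell_a$ and a set of pairwise skew lines $\ell'_1,\dots,\ell'_b$ such that $Z=\{\ell_j\cap\ell'_k : j\in\{1,\dots,a\},\ k\in\{1,\dots,b\}\}$; in particular, for all $j,k$ the lines $\ell_j,\ell'_k$ are different and incident. *)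

theory Defs
  imports "HOL-Analysis.Analysis"
begin

text \<open>
  Points of the complex projective space \<open>P\<^sup>3\<close> are the one-dimensional linear subspaces of
  \<open>\<complex>\<^sup>4\<close>. The prefix \<open>vec\<close> selects linear algebra over the scalar field \<open>complex\<close>; the
  unprefixed \<open>span\<close>, \<open>subspace\<close> and \<open>dim\<close> are those of the real vector space.
\<close>

definition proj_space3 :: "(complex^4) set set" where
  "proj_space3 = {P. vec.subspace P \<and> vec.dim P = 1}"

text \<open>A line is the set of points lying in some two-dimensional linear subspace.\<close>

definition is_proj_line :: "(complex^4) set set \<Rightarrow> bool" where
  "is_proj_line l \<longleftrightarrow>
     (\<exists>W. vec.subspace W \<and> vec.dim W = 2 \<and> l = {P \<in> proj_space3. P \<subseteq> W})"

text \<open>In \<open>P\<^sup>3\<close>, two lines are skew iff they have no common point.\<close>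

definition pairwise_skew_lines :: "nat \<Rightarrow> (nat \<Rightarrow> (complex^4) set set) \<Rightarrow> bool" where
  "pairwise_skew_lines n l \<longleftrightarrow>
     (\<forall>i\<in>{1..n}. is_proj_line (l i)) \<and>
     (\<forall>i\<in>{1..n}. \<forall>j\<in>{1..n}. i \<noteq> j \<longrightarrow> l i \<inter> l j = {})"

definition is_grid :: "nat \<Rightarrow> nat \<Rightarrow> (complex^4) set set \<Rightarrow> bool" where
  "is_grid a b Z \<longleftrightarrow>
     card Z = a * b \<and>
     (\<exists>l l'. pairwise_skew_lines a l \<and> pairwise_skew_lines b l' \<and>
        (\<forall>j\<in>{1..a}. \<forall>k\<in>{1..b}. l j \<noteq> l' k \<and> l j \<inter> l' k \<noteq> {}) \<and>
        Z = {P. \<exists>j\<in>{1..a}. \<exists>k\<in>{1..b}. l j \<inter> l' k = {P}})"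

text \<open>
  The point with homogeneous coordinates \<open>[x:y:z:w]\<close>; it belongs to \<open>P\<^sup>3\<close> only if the
  coordinates are not all zero.
\<close>

definition hpoint :: "complex \<Rightarrow> complex \<Rightarrow> complex \<Rightarrow> complex \<Rightarrow> (complex^4) set" where
  "hpoint x y z w = vec.span {vector [x, y, z, w]}"

definition klein_configuration :: "(complex^4) set set" where
  "klein_configuration =
     {hpoint 1 0 0 0, hpoint 0 1 0 0, hpoint 0 0 1 0, hpoint 0 0 0 1} \<union>
     (\<Union>u\<in>{1, \<i>, -1, -\<i>}.
        {hpoint 1 u 0 0, hpoint 1 0 u 0, hpoint 1 0 0 u,
         hpoint 0 1 u 0, hpoint 0 1 0 u, hpoint 0 0 1 u}) \<union>
     (\<Union>r\<in>{1, -1}. \<Union>s\<in>{1, -1}. \<Union>t\<in>{1, -1}.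
        {hpoint 1 r s t,
         hpoint 1 r (s * \<i>) (t * \<i>),
         hpoint 1 (r * \<i>) s (t * \<i>),
         hpoint 1 (r * \<i>) (s * \<i>) t})"

lemma vector_4:
  "(vector [x, y, z, w] :: 'a::zero^4) $ 1 = x"
  "(vector [x, y, z, w] :: 'a::zero^4) $ 2 = y"
  "(vector [x, y, z, w] :: 'a::zero^4) $ 3 = z"
  "(vector [x, y, z, w] :: 'a::zero^4) $ 4 = w"
  by (simp_all add: vector_def)

lemma hpoint_in_proj_space3:
  assumes "(x, y, z, w) \<noteq> (0, 0, 0, 0)"
  shows "hpoint x y z w \<in> proj_space3"
proof -
  have "vector [x, y, z, w] \<noteq> (0 :: complex^4)"
    using assms vector_4[of x y z w] by (metis zero_index)
  then have "vec.dim {vector [x, y, z, w] :: complex^4} = 1"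
    by (subst vec.dim_eq_card_independent) (auto simp: vec.independent_insert)
  then show ?thesis
    by (simp add: proj_space3_def hpoint_def vec.dim_span vec.subspace_span)
qed

end

theory Submission
  imports Defs
begin

text \<open>
  Up to scaling, the points of the configuration have all their coordinates in
  \<open>{0, 1, -1, \<i>, -\<i>}\<close>. On a line some two homogeneous coordinates determine the point through
  their ratio, which here takes at most six values, so a line contains at most six points of the
  configuration. The lines of either family of an \<open>(a,b)\<close>-grid cover it; hence \<open>a b \<le> 6 a\<close>,
  \<open>a b \<le> 6 b\<close>, and the grid has at most 36 points. The points with
  first coordinate 1 alone are 45.
\<close>

text \<open>This is Gaussian elimination on a basis of \<open>W\<close>: \<open>i\<close> is a pivot
  of the first vector, and \<open>j\<close> a pivot of the second after its \<open>i\<close>-th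
  coordinate has been cleared. The resulting system is triangular, so the two coordinates separate
  the vectors of \<open>W\<close>.\<close>

lemma plane_coordinates:
  fixes W :: "('a::field ^ 'n) set"
  assumes W: "vec.subspace W" and dim: "vec.dim W = 2"
  obtains i j where "\<And>x. x \<in> W \<Longrightarrow> x $ i = 0 \<Longrightarrow> x $ j = 0 \<Longrightarrow> x = 0"
proof -
  obtain B where B: "B \<subseteq> W" "vec.independent B" "W \<subseteq> vec.span B" "card B = 2"
    using vec.basis_exists[of W] dim by metis
  then obtain p q where pq: "B = {p, q}" "p \<noteq> q"
    by (auto simp: card_2_iff)
  then have "p \<noteq> 0"
    using B(2) vec.dependent_zero by blast
  then obtain i where i: "p $ i \<noteq> 0"
    by (auto simp: vec_eq_iff)
  define r where "r = q - (q $ i / p $ i) *s p"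
  have "q \<notin> vec.span {p}"
    using B(2) pq vec.independent_insert[of q "{p}"] by (auto simp: insert_commute)
  then have "r \<noteq> 0"
    unfolding r_def by (metis eq_iff_diff_eq_0 singletonI vec.span_base vec.span_scale)
  then obtain j where j: "r $ j \<noteq> 0"
    by (auto simp: vec_eq_iff)
  have ri: "r $ i = 0"
    using i by (simp add: r_def)
  have "x = 0" if "x \<in> W" "x $ i = 0" "x $ j = 0" for x
  proof -
    have "x \<in> vec.span {q, p}"
      using that B pq by (auto simp: insert_commute)
    then obtain k where "x - k *s q \<in> vec.span {p}"
      by (auto simp: vec.span_insert)
    then obtain m where "x - k *s q = m *s p"
      by (auto simp: vec.span_singleton)
    then have x: "x = (m + k * (q $ i / p $ i)) *s p + k *s r"
      by (simp add: r_def vec_eq_iff algebra_simps)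
    define c where "c = m + k * (q $ i / p $ i)"
    have x: "x = c *s p + k *s r"
      using x by (simp only: c_def)
    \<comment> \<open>Since \<open>r $ i = 0\<close>, coordinate \<open>i\<close> of
      \<open>x\<close> is \<open>c * p $ i\<close>, which isolates \<open>c\<close>; coordinate
      \<open>j\<close> then isolates \<open>k\<close>.\<close>
    with that(2) i ri have "c = 0"
      by simp
    with x that(3) j show "x = 0"
      by simp
  qed
  then show thesis
    by (rule that)
qed

lemma span_singleton_eqI:
  fixes u v :: "'a::field ^ 'n"
  assumes "c *s u = d *s v" "c \<noteq> 0" "d \<noteq> 0"
  shows "vec.span {u} = vec.span {v}"
proof -
  have "u \<in> vec.span {v}" if "c *s u = d *s v" "c \<noteq> 0" for c d and u v :: "'a ^ 'n"
  proof -
    have "c *s u \<in> vec.span {v}"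
      using that by (simp add: vec.span_base vec.span_scale)
    from vec.span_scale[OF this, of "inverse c"] that(2) show ?thesis
      by simp
  qed
  from this[OF assms(1,2)] this[OF assms(1)[symmetric] assms(3)] show ?thesis
    by (simp add: vec.span_eq)
qed

lemma card_line_Int_le_6:
  assumes "is_proj_line l"
    and Z: "\<And>P. P \<in> Z \<Longrightarrow>
      \<exists>v. v \<noteq> 0 \<and> P = vec.span {v} \<and> (\<forall>k. v $ k \<in> {0, 1, -1, \<i>, -\<i>})"
  shows "card (Z \<inter> l) \<le> 6"
proof -
  obtain W where W: "vec.subspace W" "vec.dim W = 2" and l: "l = {P \<in> proj_space3. P \<subseteq> W}"
    using assms(1) by (auto simp: is_proj_line_def)
  obtain i j where ij: "\<And>x. x \<in> W \<Longrightarrow> x $ i = 0 \<Longrightarrow> x $ j = 0 \<Longrightarrow> x = 0"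
    using plane_coordinates[OF W] by blast
  obtain v where v: "\<And>P. P \<in> Z \<Longrightarrow> v P \<noteq> 0 \<and> P = vec.span {v P} \<and>
      (\<forall>k. v P $ k \<in> {0, 1, -1, \<i>, -\<i>})"
    using Z by metis
  have vW: "v P \<in> W" if "P \<in> Z \<inter> l" for P
    using that v[of P] l vec.span_base[of "v P" "{v P}"] by auto
  \<comment> \<open>The ratio of coordinates \<open>j\<close> and \<open>i\<close>, with
    \<open>None\<close> as the point at infinity; it does not depend on the representative
    \<open>v P\<close>.\<close>
  define f where "f P = (if v P $ i = 0 then None else Some (v P $ j / v P $ i))" for P
  have "inj_on f (Z \<inter> l)"
  proof (rule inj_onI)
    fix P Q assume P: "P \<in> Z \<inter> l" and Q: "Q \<in> Z \<inter> l" and eq: "f P = f Q"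
    \<comment> \<open>Cross-multiplied, the equality also covers \<open>None\<close>, where both
      sides are 0.\<close>
    have ratio: "v P $ i * v Q $ j = v P $ j * v Q $ i"
      using eq by (auto simp: f_def field_simps split: if_splits)
    \<comment> \<open>The difference of the two sides lies in \<open>W\<close>. Its coordinate
      \<open>k\<close> cancels identically and the other one vanishes by \<open>ratio\<close>, so it
      is 0.\<close>
    have *: "v Q $ k *s v P = v P $ k *s v Q" if "k \<in> {i, j}" for k
    proof -
      have "v Q $ k *s v P - v P $ k *s v Q \<in> W"
        by (intro vec.subspace_diff vec.subspace_scale W vW P Q)
      then have "v Q $ k *s v P - v P $ k *s v Q = 0"
        by (rule ij) (use that ratio in \<open>auto simp: algebra_simps\<close>)
      then show ?thesis
        by simp
    qed
    \<comment> \<open>Take \<open>k = i\<close> for a finite ratio. For \<open>None\<close> both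
      \<open>i\<close>-th coordinates are 0, so both \<open>j\<close>-th coordinates are
      nonzero.\<close>
    have "\<exists>k\<in>{i, j}. v P $ k \<noteq> 0 \<and> v Q $ k \<noteq> 0"
      using eq ij[OF vW[OF P]] ij[OF vW[OF Q]] v[of P] v[of Q] P Q
      by (auto simp: f_def split: if_splits)
    then obtain k where "k \<in> {i, j}" "v P $ k \<noteq> 0" "v Q $ k \<noteq> 0"
      by blast
    then have "vec.span {v P} = vec.span {v Q}"
      using * span_singleton_eqI by blast
    then show "P = Q"
      using v P Q by auto
  qed
  \<comment> \<open>The five allowed coordinates are closed under division by the nonzero ones;
    \<open>None\<close> is the sixth value.\<close>
  moreover have "f ` (Z \<inter> l) \<subseteq> insert None (Some ` {0, 1, -1, \<i>, -\<i>})"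
  proof (rule image_subsetI)
    fix P assume "P \<in> Z \<inter> l"
    then have "v P $ i \<in> {0, 1, -1, \<i>, -\<i>}" "v P $ j \<in> {0, 1, -1, \<i>, -\<i>}"
      using v[of P] by blast+
    then show "f P \<in> insert None (Some ` {0, 1, -1, \<i>, -\<i>})"
      by (auto simp: f_def)
  qed
  ultimately have "card (Z \<inter> l) \<le> card (insert None (Some ` {0, 1, -1, \<i>, -\<i>}))"
    by (intro card_inj_on_le) auto
  also have "\<dots> \<le> 6"
    by (simp add: card_insert_if)
  finally show ?thesis .
qed

text \<open>Proportional vectors that both have first coordinate 1 have proportionality factor
  1.\<close>

lemma hpoint_1_inj:
  assumes "hpoint 1 x y z = hpoint 1 x' y' z'"
  shows "x = x' \<and> y = y' \<and> z = z'"
proof -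
  have "vector [1, x, y, z] \<in> hpoint 1 x' y' z'"
    using assms vec.span_base unfolding hpoint_def by blast
  then obtain c where "vector [1, x, y, z] = c *s (vector [1, x', y', z'] :: complex^4)"
    by (auto simp: hpoint_def vec.span_singleton)
  then show ?thesis
    by (simp add: vec_eq_iff forall_4 vector_4)
qed

lemma klein_configuration_representative:
  assumes "P \<in> klein_configuration"
  shows "\<exists>v. v \<noteq> 0 \<and> P = vec.span {v} \<and> (\<forall>k. v $ k \<in> {0, 1, -1, \<i>, -\<i>})"
proof -
  define R :: "(complex^4) set set" where
    "R = {vec.span {v} |v. v \<noteq> 0 \<and> (\<forall>k. v $ k \<in> {0, 1, -1, \<i>, -\<i>})}"
  have "hpoint x y z w \<in> R"
    if "(x, y, z, w) \<noteq> (0, 0, 0, 0)" "{x, y, z, w} \<subseteq> {0, 1, -1, \<i>, -\<i>}" for x y z w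
    unfolding R_def hpoint_def using that
    by (intro CollectI exI[of _ "vector [x, y, z, w]"])
      (simp add: vec_eq_iff forall_4 vector_4)
  then have "klein_configuration \<subseteq> R"
    by (simp add: klein_configuration_def)
  with assms show ?thesis
    by (auto simp: R_def)
qed

lemma card_klein_configuration_ge_45: "45 \<le> card klein_configuration"
proof -
  \<comment> \<open>The last three coordinates of the points with first coordinate 1: one coordinate
    point, 3 * 4 points with two nonzero coordinates and 4 * 8 with four, in total 45.\<close>
  define S :: "(complex \<times> complex \<times> complex) set" where "S =
     insert (0, 0, 0)
     ((\<Union>u\<in>{1, \<i>, -1, -\<i>}. {(u, 0, 0), (0, u, 0), (0, 0, u)}) \<union>
     (\<Union>r\<in>{1, -1}. \<Union>s\<in>{1, -1}. \<Union>t\<in>{1, -1}.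
        {(r, s, t), (r, s * \<i>, t * \<i>), (r * \<i>, s, t * \<i>), (r * \<i>, s * \<i>, t)}))"
  have i_neq: "\<i> \<noteq> -1" "-1 \<noteq> \<i>" "-\<i> \<noteq> 1"
    by (simp_all add: complex_eq_iff)
  have "finite klein_configuration"
    by (simp add: klein_configuration_def)
  moreover have "inj_on (\<lambda>(x, y, z). hpoint 1 x y z) S"
    by (auto intro!: inj_onI dest!: hpoint_1_inj)
  moreover have "(\<lambda>(x, y, z). hpoint 1 x y z) ` S \<subseteq> klein_configuration"
    by (simp add: S_def klein_configuration_def)
  ultimately have "card S \<le> card klein_configuration"
    using card_inj_on_le by blast
  moreover have "card S = 45"
    by (simp add: S_def card_insert_if i_neq)
  ultimately show ?thesis
    by simp
qed

text \<open>A union bound: each of the \<open>n\<close> covering lines carries at most 6 of the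
  points.\<close>

lemma card_le_lines:
  assumes "pairwise_skew_lines n l" "klein_configuration \<subseteq> (\<Union>j\<in>{1..n}. l j)"
  shows "card klein_configuration \<le> 6 * n"
proof -
  have "klein_configuration = (\<Union>j\<in>{1..n}. klein_configuration \<inter> l j)"
    using assms(2) by blast
  then have "card klein_configuration \<le> (\<Sum>j\<in>{1..n}. card (klein_configuration \<inter> l j))"
    by (metis card_UN_le finite_atLeastAtMost)
  also have "\<dots> \<le> (\<Sum>j\<in>{1..n}. 6)"
    using assms(1) card_line_Int_le_6 klein_configuration_representative
    by (intro sum_mono) (auto simp: pairwise_skew_lines_def)
  finally show ?thesis
    by simp
qed

theorem proposition5p4:
  fixes a b :: nat
  assumes "a > 0" and "b > 0"
  shows "\<not> is_grid a b klein_configuration"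
proof
  assume "is_grid a b klein_configuration"
  then obtain l l' where card: "card klein_configuration = a * b"
    and skew: "pairwise_skew_lines a l" "pairwise_skew_lines b l'"
    and Z: "klein_configuration = {P. \<exists>j\<in>{1..a}. \<exists>k\<in>{1..b}. l j \<inter> l' k = {P}}"
    unfolding is_grid_def by (elim conjE exE) (rule that)
  have "klein_configuration \<subseteq> (\<Union>j\<in>{1..a}. l j)" "klein_configuration \<subseteq> (\<Union>k\<in>{1..b}. l' k)"
    unfolding Z by blast+
  then have "a * b \<le> 6 * a" "a * b \<le> 6 * b"
    using card_le_lines[OF skew(1)] card_le_lines[OF skew(2)] card by simp_all
  \<comment> \<open>Each family bounds the size of the other: cancelling \<open>a > 0\<close> in the
    first inequality gives \<open>b \<le> 6\<close>, and cancelling \<open>b > 0\<close> in the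
    second gives \<open>a \<le> 6\<close>.\<close>
  then have "a \<le> 6" "b \<le> 6"
    using assms by simp_all
  then have "a * b \<le> 6 * 6"
    by (rule mult_le_mono)
  with card card_klein_configuration_ge_45 show False
    by simp
qed

end
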